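(* Let $\mathcal{C}$ be a CMV matrix whose Verblunsky coefficients $\alpha_0,\alpha_1,\alpha_2,\dots$ are not all zero, and let $n\in\mathbb{N}$. If $\Omega$ is an almost tridiagonal matrix such that $(\mathrm{ad}_n\,\mathcal{C})\Omega=0$, then $\Omega$ is a scalar multiple of the infinite identity matrix $I$.
   Context: All matrices are complex and infinite, with rows and columns indexed by $0,1,2,\dots$; $A^\dagger$ is the conjugate transpose and $A^t$ the transpose. A band matrix is one with only finitely many nonzero diagonals. Given a sequence $(\alpha_n)_{n\ge0}$ (the Verblunsky coefficients) in the open unit disk, put $\rho_n=\sqrt{1-|\alpha_n|^2}$, $\Theta_n=\begin{pmatrix}\overline{\alpha}_n&\rho_n\\ \rho_n&-\alpha_n\end{pmatrix}$, $\mathcal{L}=\Theta_0\oplus\Theta_2\oplus\Theta_4\oplus\cdots$, $\mathcal{M}=(1)\oplus\Theta_1\oplus\Theta_3\oplus\cdots$. The CMV matrix is $\mathcal{C}=\mathcal{L}\mathcal{M}$ (a five-diagonal unitary matrix; $\mathcal{L},\mathcal{M}$ are symmetric and unitary). For a band matrix $\Omega$, $(\mathrm{ad}\,\mathcal{C})\Omega=\mathcal{C}\Omega-\Omega\mathcal{C}$, $(\mathrm{ad}\,\mathcal{C})^n$ is its $n$-th iterate, and $$(\mathrm{ad}_n\,\mathcal{C})\Omega:=\begin{cases}(\mathcal{C}^\dagger)^m\,\big((\mathrm{ad}\,\mathcal{C})^n\Omega\big)\,(\mathcal{C}^\dagger)^m,& n=2m,\\ \mathcal{L}^\dagger(\mathcal{C}^\dagger)^m\,\big((\mathrm{ad}\,\mathcal{C})^n\Omega\big)\,(\mathcal{C}^\dagger)^m\mathcal{M}^\dagger,&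 n=2m+1.\end{cases}$$ A matrix $\Omega$ is almost tridiagonal if $\Omega-\widetilde\Omega$ has finitely many nonzero entries for some infinite tridiagonal matrix $\widetilde\Omega$. *)

theory Defs
  imports Complex_Main
begin

type_synonym imat = "nat \<Rightarrow> nat \<Rightarrow> complex"

definition band :: "imat \<Rightarrow> bool" where
  "band A \<longleftrightarrow> (\<exists>d. \<forall>i j. A i j \<noteq> 0 \<longrightarrow> i \<le> j + d \<and> j \<le> i + d)"

definition tridiagonal :: "imat \<Rightarrow> bool" where
  "tridiagonal A \<longleftrightarrow> (\<forall>i j. A i j \<noteq> 0 \<longrightarrow> i \<le> j + 1 \<and> j \<le> i + 1)"

definition almost_tridiagonal :: "imat \<Rightarrow> bool" where
  "almost_tridiagonal A \<longleftrightarrow>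
     (\<exists>T. tridiagonal T \<and> finite {(i, j). A i j - T i j \<noteq> 0})"

definition imat_zero :: imat where
  "imat_zero = (\<lambda>i j. 0)"

definition imat_one :: imat where
  "imat_one = (\<lambda>i j. if i = j then 1 else 0)"

definition imat_smult :: "complex \<Rightarrow> imat \<Rightarrow> imat" where
  "imat_smult c A = (\<lambda>i j. c * A i j)"

definition imat_diff :: "imat \<Rightarrow> imat \<Rightarrow> imat" where
  "imat_diff A B = (\<lambda>i j. A i j - B i j)"

(* The series has finitely many nonzero terms as soon as one factor is a band matrix
   (imat_mult_band_left, imat_mult_band_right). All products below are of band matrices. *)
definition imat_mult :: "imat \<Rightarrow> imat \<Rightarrow> imat"  (infixl "\<odot>" 70) where
  "A \<odot> B = (\<lambda>i j. \<Sum>k. A i k * B k j)"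

primrec imat_pow :: "imat \<Rightarrow> nat \<Rightarrow> imat" where
  "imat_pow A 0 = imat_one"
| "imat_pow A (Suc n) = A \<odot> imat_pow A n"

definition adjoint :: "imat \<Rightarrow> imat" where
  "adjoint A = (\<lambda>i j. cnj (A j i))"

definition rho :: "(nat \<Rightarrow> complex) \<Rightarrow> nat \<Rightarrow> real" where
  "rho \<alpha> n = sqrt (1 - (cmod (\<alpha> n))\<^sup>2)"

(* A 2 x 2 matrix is encoded as a function of which only the entries with indices
   in {0, 1} are used. *)
definition Theta :: "(nat \<Rightarrow> complex) \<Rightarrow> nat \<Rightarrow> nat \<Rightarrow> nat \<Rightarrow> complex" where
  "Theta \<alpha> n r s =
     (if r = 0 \<and> s = 0 then cnj (\<alpha> n)
      else if r = 1 \<and> s = 1 then - \<alpha> n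
      else complex_of_real (rho \<alpha> n))"

(* B 0 \<oplus> B 1 \<oplus> B 2 \<oplus> ... for a sequence of 2 x 2 blocks *)
definition block_sum :: "(nat \<Rightarrow> nat \<Rightarrow> nat \<Rightarrow> complex) \<Rightarrow> imat" where
  "block_sum B = (\<lambda>i j. if i div 2 = j div 2 then B (i div 2) (i mod 2) (j mod 2) else 0)"

(* (1) \<oplus> A *)
definition one_oplus :: "imat \<Rightarrow> imat" where
  "one_oplus A = (\<lambda>i j. if i = 0 \<and> j = 0 then 1
                          else if i = 0 \<or> j = 0 then 0
                          else A (i - 1) (j - 1))"

definition cmv_L :: "(nat \<Rightarrow> complex) \<Rightarrow> imat" where
  "cmv_L \<alpha> = block_sum (\<lambda>k. Theta \<alpha> (2 * k))"

definition cmv_M :: "(nat \<Rightarrow> complex) \<Rightarrow> imat" where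
  "cmv_M \<alpha> = one_oplus (block_sum (\<lambda>k. Theta \<alpha> (2 * k + 1)))"

definition cmv :: "(nat \<Rightarrow> complex) \<Rightarrow> imat" where
  "cmv \<alpha> = cmv_L \<alpha> \<odot> cmv_M \<alpha>"

definition ad :: "imat \<Rightarrow> imat \<Rightarrow> imat" where
  "ad A X = imat_diff (A \<odot> X) (X \<odot> A)"

definition ad_n :: "(nat \<Rightarrow> complex) \<Rightarrow> nat \<Rightarrow> imat \<Rightarrow> imat" where
  "ad_n \<alpha> n X =
     (let m = n div 2;
          P = imat_pow (adjoint (cmv \<alpha>)) m;
          Y = (ad (cmv \<alpha>) ^^ n) X
      in if even n then P \<odot> Y \<odot> P
         else adjoint (cmv_L \<alpha>) \<odot> P \<odot> Y \<odot> P \<odot> adjoint (cmv_M \<alpha>))"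

lemma imat_mult_band_left:
  assumes "band A"
  shows "finite {k. A i k \<noteq> 0}" "(A \<odot> B) i j = (\<Sum>k | A i k \<noteq> 0. A i k * B k j)"
proof -
  obtain d where d: "\<And>i j. A i j \<noteq> 0 \<Longrightarrow> i \<le> j + d \<and> j \<le> i + d"
    using assms unfolding band_def by blast
  show fin: "finite {k. A i k \<noteq> 0}"
    by (rule finite_subset[of _ "{..i + d}"]) (use d in auto)
  show "(A \<odot> B) i j = (\<Sum>k | A i k \<noteq> 0. A i k * B k j)"
    unfolding imat_mult_def by (rule suminf_finite[OF fin]) auto
qed

lemma imat_mult_band_right:
  assumes "band B"
  shows "finite {k. B k j \<noteq> 0}" "(A \<odot> B) i j = (\<Sum>k | B k j \<noteq> 0. A i k * B k j)"
proof -
  obtain d where d: "\<And>i j. B i j \<noteq> 0 \<Longrightarrow> i \<le> j + d \<and> j \<le> i + d"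
    using assms unfolding band_def by blast
  show fin: "finite {k. B k j \<noteq> 0}"
    by (rule finite_subset[of _ "{..j + d}"]) (use d in auto)
  show "(A \<odot> B) i j = (\<Sum>k | B k j \<noteq> 0. A i k * B k j)"
    unfolding imat_mult_def by (rule suminf_finite[OF fin]) auto
qed

lemma band_mult:
  assumes "band A" "band B"
  shows "band (A \<odot> B)"
proof -
  obtain d where d: "\<And>i j. A i j \<noteq> 0 \<Longrightarrow> i \<le> j + d \<and> j \<le> i + d"
    using assms(1) unfolding band_def by blast
  obtain e where e: "\<And>i j. B i j \<noteq> 0 \<Longrightarrow> i \<le> j + e \<and> j \<le> i + e"
    using assms(2) unfolding band_def by blast
  have "i \<le> j + (d + e) \<and> j \<le> i + (d + e)" if "(A \<odot> B) i j \<noteq> 0" for i j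
  proof -
    have "(\<Sum>k | A i k \<noteq> 0. A i k * B k j) \<noteq> 0"
      using that imat_mult_band_left(2)[OF assms(1)] by simp
    then obtain k where "A i k * B k j \<noteq> 0"
      by (rule sum.not_neutral_contains_not_neutral)
    then have "A i k \<noteq> 0" "B k j \<noteq> 0"
      by simp_all
    then show ?thesis using d[of i k] e[of k j] by auto
  qed
  then show ?thesis unfolding band_def by blast
qed

lemma band_block_sum: "band (block_sum B)"
proof -
  have "i \<le> j + 1 \<and> j \<le> i + 1" if "block_sum B i j \<noteq> 0" for i j
  proof -
    have "i div 2 = j div 2"
      using that by (simp add: block_sum_def split: if_splits)
    then show ?thesis by presburger
  qed
  then show ?thesis unfolding band_def by blast
qed

lemma band_one_oplus:
  assumes "band A"
  shows "band (one_oplus A)"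
proof -
  obtain d where d: "\<And>i j. A i j \<noteq> 0 \<Longrightarrow> i \<le> j + d \<and> j \<le> i + d"
    using assms unfolding band_def by blast
  have "i \<le> j + d \<and> j \<le> i + d" if "one_oplus A i j \<noteq> 0" for i j
  proof (cases "i = 0 \<or> j = 0")
    case True
    then show ?thesis using that unfolding one_oplus_def by (auto split: if_splits)
  next
    case False
    then have "A (i - 1) (j - 1) \<noteq> 0"
      using that by (simp add: one_oplus_def)
    then have "i - 1 \<le> j - 1 + d \<and> j - 1 \<le> i - 1 + d" by (rule d)
    then show ?thesis using False by linarith
  qed
  then show ?thesis unfolding band_def by blast
qed

lemma band_cmv_L: "band (cmv_L \<alpha>)"
  unfolding cmv_L_def by (rule band_block_sum)

lemma band_cmv_M: "band (cmv_M \<alpha>)"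
  unfolding cmv_M_def by (intro band_one_oplus band_block_sum)

lemma band_cmv: "band (cmv \<alpha>)"
  unfolding cmv_def by (intro band_mult band_cmv_L band_cmv_M)

lemma band_almost_tridiagonal:
  assumes "almost_tridiagonal A"
  shows "band A"
proof -
  obtain T where T: "tridiagonal T" and fin: "finite {(i, j). A i j - T i j \<noteq> 0}"
    using assms unfolding almost_tridiagonal_def by blast
  let ?S = "{(i, j). A i j - T i j \<noteq> 0}"
  obtain d where d: "\<And>p. p \<in> ?S \<Longrightarrow> fst p + snd p \<le> d"
    using finite_imageI[OF fin, of "\<lambda>p. fst p + snd p"]
    by (meson finite_nat_set_iff_bounded_le image_eqI)
  have "i \<le> j + (d + 1) \<and> j \<le> i + (d + 1)" if "A i j \<noteq> 0" for i j
  proof (cases "A i j = T i j")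
    case True
    with that T show ?thesis unfolding tridiagonal_def by fastforce
  next
    case False
    then show ?thesis using d[of "(i, j)"] by auto
  qed
  then show ?thesis unfolding band_def by blast
qed

end

theory Submission
  imports Defs
begin

text \<open>
  Write \<open>v\<^sub>k = C\<^sup>k e\<^sub>0\<close> for an integer \<open>k\<close>, where \<open>C\<close> is the CMV matrix and \<open>C\<^sup>-\<^sup>1\<close> is its
  adjoint.  In the picture of the orthogonal polynomials on the unit circle, \<open>v\<^sub>k\<close> is the
  monomial \<open>z\<^sup>k\<close>, the standard basis is the orthonormal basis obtained from
  \<open>1, z, z\<^sup>-\<^sup>1, z\<^sup>2, z\<^sup>-\<^sup>2, \<dots>\<close>, and a matrix killed by a power of \<open>ad C\<close> is a differential
  operator in \<open>z\<close>.  The proof shows that such an operator, if almost tridiagonal, is a polynomial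
  in \<open>z d/dz\<close>; comparing it with its adjoint then leaves only the constants.

  Up to invertible factors, \<open>ad C\<close> is the operation \<open>\<delta> X = C\<^sup>-\<^sup>1 X C - X\<close>, so \<open>\<delta>\<^sup>n \<Omega> = 0\<close>.  This
  says that \<open>w\<^sub>k = C\<^sup>-\<^sup>k \<Omega> C\<^sup>k e\<^sub>0\<close> has vanishing \<open>n\<close>-th differences in \<open>k\<close>: every
  coordinate of \<open>w\<^sub>k\<close> is polynomial in \<open>k\<close>.  All the \<open>w\<^sub>k\<close> are supported in a common
  \<open>{0..d}\<close>.  Suppose that \<open>d > 0\<close>.  Large positive powers of \<open>C\<close> (for odd \<open>d\<close>), or of \<open>C\<^sup>-\<^sup>1\<close>
  (for even \<open>d\<close>), carry the coordinate \<open>d\<close> of \<open>w\<^sub>k\<close> to a coordinate of \<open>\<Omega> v\<^sub>k\<close> that lies at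
  least two places above the support of \<open>v\<^sub>k\<close>, where it must vanish because \<open>\<Omega>\<close> is
  almost tridiagonal.  A polynomial that vanishes far out is zero, so \<open>d\<close> can be lowered
  (\<open>lower_support\<close>).  In the end \<open>w\<^sub>k\<close> is a multiple of \<open>e\<^sub>0\<close>, that is,
  \<open>\<Omega> v\<^sub>k = b(k) v\<^sub>k\<close>, with \<open>b\<close> polynomial (\<open>zpow_eigenvector\<close>).

  The adjoint of \<open>\<Omega>\<close> satisfies the same hypotheses, hence has the \<open>v\<^sub>k\<close> as eigenvectors as
  well.  Comparing both, \<open>b(k) = b(j)\<close> whenever the moment \<open>c\<^sub>k\<^sub>-\<^sub>j = \<langle>v\<^sub>j, v\<^sub>k\<rangle>\<close> is nonzero.  If some
  \<open>c\<^sub>m\<close> with \<open>m \<noteq> 0\<close> is nonzero, then \<open>b\<close> is a periodic polynomial, thus constant, and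
  \<open>\<Omega>\<close> is scalar because the \<open>v\<^sub>k\<close> form a triangular basis.  Otherwise the \<open>v\<^sub>k\<close> are orthonormal,
  hence multiples of the standard basis vectors, and this forces all Verblunsky coefficients to be
  zero (\<open>moments_determine_zero\<close>).
\<close>

section \<open>Functions on the integers with vanishing iterated differences\<close>

text \<open>The condition \<open>(diff ^^ n) f = 0\<close> characterises the polynomials of degree less than \<open>n\<close>.  It
  serves as the definition of polynomial dependence on an integer, since the facts used about
  polynomials follow from it by induction on \<open>n\<close>.\<close>

definition diff :: "(int \<Rightarrow> 'a::ab_group_add) \<Rightarrow> int \<Rightarrow> 'a" where
  "diff f = (\<lambda>k. f (k + 1) - f k)"

lemma diff_pow_Suc: "(diff ^^ Suc n) f = (diff ^^ n) (diff f)"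
  by (simp add: funpow_swap1)

lemma diff_eq_0_const:
  assumes "diff f = (\<lambda>_. 0)"
  shows "f k = f j"
proof -
  have step: "f (i + 1) = f i" for i
    using fun_cong[OF assms, of i] by (simp add: diff_def)
  show ?thesis
  proof (induction k rule: int_induct[of _ j])
    case (step2 i)
    then show ?case using step[of "i - 1"] by simp
  qed (simp_all add: step)
qed

text \<open>A polynomial that vanishes on a half line is zero: by induction the same holds for its
  difference, so it is constant.\<close>

lemma diff_pow_eq_0_half_line:
  fixes f :: "int \<Rightarrow> 'a::ab_group_add"
  assumes "(diff ^^ n) f = (\<lambda>_. 0)"
    and "(\<forall>k\<ge>K. f k = 0) \<or> (\<forall>k\<le>K. f k = 0)"
  shows "f k = 0"
  using assms
proof (induction n arbitrary: f K k)
  case 0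
  then show ?case by (simp add: fun_eq_iff)
next
  case (Suc n)
  have "(diff ^^ n) (diff f) = (\<lambda>_. 0)"
    using Suc.prems(1) by (simp only: diff_pow_Suc)
  moreover have "(\<forall>k\<ge>K. diff f k = 0) \<or> (\<forall>k\<le>K - 1. diff f k = 0)"
    using Suc.prems(2) by (auto simp: diff_def)
  ultimately have "diff f = (\<lambda>_. 0)"
    using Suc.IH by blast
  then have "f k = f K" by (rule diff_eq_0_const)
  then show ?case using Suc.prems(2) by auto
qed

text \<open>A periodic polynomial is constant: by induction its difference is a constant \<open>c\<close>, so \<open>f\<close> is
  affine with slope \<open>c\<close>, and going through a period shows \<open>c = 0\<close>.\<close>

lemma diff_pow_eq_0_periodic:
  fixes f :: "int \<Rightarrow> 'a::field_char_0"
  assumes "(diff ^^ n) f = (\<lambda>_. 0)"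
    and "m \<noteq> 0" and "\<And>k. f (k + m) = f k"
  shows "f k = f 0"
  using assms
proof (induction n arbitrary: f k)
  case 0
  then show ?case by (simp add: fun_eq_iff)
next
  case (Suc n)
  have "(diff ^^ n) (diff f) = (\<lambda>_. 0)"
    using Suc.prems(1) by (simp only: diff_pow_Suc)
  moreover have "diff f (k + m) = diff f k" for k
    using Suc.prems(3)[of k] Suc.prems(3)[of "k + 1"] by (simp add: diff_def algebra_simps)
  ultimately have const: "diff f k = diff f 0" for k
    using Suc.IH Suc.prems(2) by blast
  let ?c = "diff f 0"
  let ?g = "\<lambda>k. f k - of_int k * ?c"
  have "diff ?g = (\<lambda>_. 0)"
    using const by (auto simp: diff_def fun_eq_iff algebra_simps)
  then have "?g m = ?g 0" by (rule diff_eq_0_const)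
  moreover have "f m = f 0" using Suc.prems(3)[of 0] by simp
  ultimately have "?c = 0" using Suc.prems(2) by simp
  then have "diff f = (\<lambda>_. 0)" using const by auto
  then show ?case by (rule diff_eq_0_const)
qed

section \<open>The ring of band matrices\<close>

text \<open>Row \<open>i\<close> of a band matrix is supported below some bound, so the series defining an entry of a
  product is a sum over any sufficiently long initial segment.\<close>

lemma imat_mult_lessThan:
  assumes "\<And>k. A i k \<noteq> 0 \<Longrightarrow> k < n"
  shows "(A \<odot> B) i j = (\<Sum>k<n. A i k * B k j)"
  unfolding imat_mult_def by (rule suminf_finite) (use assms in auto)

lemma imat_mult_assoc:
  assumes "band A" "band B"
  shows "A \<odot> B \<odot> C = A \<odot> (B \<odot> C)"
proof (intro ext)
  fix i j
  obtain d where d: "\<And>i j. A i j \<noteq> 0 \<Longrightarrow> i \<le> j + d \<and> j \<le> i + d"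
    using assms(1) unfolding band_def by blast
  obtain e where e: "\<And>i j. B i j \<noteq> 0 \<Longrightarrow> i \<le> j + e \<and> j \<le> i + e"
    using assms(2) unfolding band_def by blast
  define n where "n = Suc (i + d + e)"
  have A: "l < n" if "A i l \<noteq> 0" for l
    using d[OF that] by (simp add: n_def)
  have B: "k < n" if "A i l \<noteq> 0" "B l k \<noteq> 0" for l k
    using d[OF that(1)] e[OF that(2)] by (simp add: n_def)
  have AB: "(A \<odot> B) i k = (\<Sum>l<n. A i l * B l k)" for k
    by (rule imat_mult_lessThan) (rule A)
  have "k < n" if "(A \<odot> B) i k \<noteq> 0" for k
  proof -
    have "(\<Sum>l<n. A i l * B l k) \<noteq> 0" using that AB by simp
    then obtain l where "A i l * B l k \<noteq> 0"
      by (rule sum.not_neutral_contains_not_neutral)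
    then show ?thesis using B by auto
  qed
  then have "(A \<odot> B \<odot> C) i j = (\<Sum>k<n. (\<Sum>l<n. A i l * B l k) * C k j)"
    by (subst imat_mult_lessThan) (auto simp: AB)
  also have "\<dots> = (\<Sum>l<n. \<Sum>k<n. A i l * (B l k * C k j))"
    by (subst sum.swap) (simp add: sum_distrib_right mult.assoc)
  also have "\<dots> = (\<Sum>l<n. A i l * (B \<odot> C) l j)"
  proof (rule sum.cong[OF refl])
    fix l
    show "(\<Sum>k<n. A i l * (B l k * C k j)) = A i l * (B \<odot> C) l j"
    proof (cases "A i l = 0")
      case False
      then have "(B \<odot> C) l j = (\<Sum>k<n. B l k * C k j)"
        by (intro imat_mult_lessThan) (rule B)
      then show ?thesis by (simp add: sum_distrib_left)
    qed simp
  qed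
  also have "\<dots> = (A \<odot> (B \<odot> C)) i j"
    by (rule imat_mult_lessThan[symmetric]) (rule A)
  finally show "(A \<odot> B \<odot> C) i j = (A \<odot> (B \<odot> C)) i j" .
qed

lemma band_add:
  assumes "band A" "band B"
  shows "band (\<lambda>i j. A i j + B i j)"
proof -
  obtain d where d: "\<And>i j. A i j \<noteq> 0 \<Longrightarrow> i \<le> j + d \<and> j \<le> i + d"
    using assms(1) unfolding band_def by blast
  obtain e where e: "\<And>i j. B i j \<noteq> 0 \<Longrightarrow> i \<le> j + e \<and> j \<le> i + e"
    using assms(2) unfolding band_def by blast
  have "i \<le> j + (d + e) \<and> j \<le> i + (d + e)" if "A i j + B i j \<noteq> 0" for i j
    using that d[of i j] e[of i j] by fastforce
  then show ?thesis unfolding band_def by blast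
qed

lemma band_uminus: "band A \<Longrightarrow> band (\<lambda>i j. - A i j)"
  by (simp add: band_def)

lemma band_smult_one: "band (imat_smult c imat_one)"
  by (auto simp: band_def imat_smult_def imat_one_def)

lemma band_adjoint: "band A \<Longrightarrow> band (adjoint A)"
  by (auto simp: band_def adjoint_def)

text \<open>The product of infinite matrices is associative only under finiteness conditions.  With the band
  condition built into a type, the algebra below takes place in a ring.\<close>

typedef band_matrix = "{A. band A}"
  morphisms entry Band
  by (auto intro: exI[of _ imat_zero] simp: band_def imat_zero_def)

setup_lifting type_definition_band_matrix

instantiation band_matrix :: ring_1
begin

lift_definition zero_band_matrix :: band_matrix is imat_zero
  by (simp add: band_def imat_zero_def)

lift_definition one_band_matrix :: band_matrix is imat_one
  by (auto simp: band_def imat_one_def)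

lift_definition plus_band_matrix :: "band_matrix \<Rightarrow> band_matrix \<Rightarrow> band_matrix"
  is "\<lambda>A B i j. A i j + B i j"
  by (rule band_add)

lift_definition uminus_band_matrix :: "band_matrix \<Rightarrow> band_matrix"
  is "\<lambda>A i j. - A i j"
  by (rule band_uminus)

lift_definition minus_band_matrix :: "band_matrix \<Rightarrow> band_matrix \<Rightarrow> band_matrix"
  is imat_diff
  using band_add[OF _ band_uminus] by (fastforce simp: imat_diff_def)

lift_definition times_band_matrix :: "band_matrix \<Rightarrow> band_matrix \<Rightarrow> band_matrix"
  is imat_mult
  by (rule band_mult)

instance
proof
  fix A B C :: band_matrix
  show "A * B * C = A * (B * C)"
    by transfer (rule imat_mult_assoc)
  show "(A + B) * C = A * C + B * C"
  proof (transfer, intro ext)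
    fix A B C :: imat and i j
    assume AB: "band A" "band B"
    obtain n where "\<And>k. A i k \<noteq> 0 \<Longrightarrow> k < n" "\<And>k. B i k \<noteq> 0 \<Longrightarrow> k < n"
    proof -
      have "finite ({k. A i k \<noteq> 0} \<union> {k. B i k \<noteq> 0})"
        using imat_mult_band_left(1) AB by blast
      then obtain n where "\<And>k. k \<in> {k. A i k \<noteq> 0} \<union> {k. B i k \<noteq> 0} \<Longrightarrow> k < n"
        unfolding finite_nat_set_iff_bounded by blast
      then show ?thesis using that[of n] by blast
    qed
    then show "((\<lambda>i j. A i j + B i j) \<odot> C) i j = (A \<odot> C) i j + (B \<odot> C) i j"
      by (subst (1 2 3) imat_mult_lessThan[of _ _ n])
        (auto simp: sum.distrib distrib_right, force)
  qed
  show "A * (B + C) = A * B + A * C"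
  proof (transfer, intro ext)
    fix A B C :: imat and i j
    assume "band A"
    then show "(A \<odot> (\<lambda>i j. B i j + C i j)) i j = (A \<odot> B) i j + (A \<odot> C) i j"
      by (simp add: imat_mult_band_left(2) sum.distrib distrib_left)
  qed
  show "1 * A = A"
  proof (transfer, intro ext)
    fix A :: imat and i j
    have "(imat_one \<odot> A) i j = (\<Sum>k<Suc i. imat_one i k * A k j)"
      by (rule imat_mult_lessThan) (auto simp: imat_one_def split: if_splits)
    then show "(imat_one \<odot> A) i j = A i j"
      by (simp add: imat_one_def)
  qed
  show "A * 1 = A"
  proof (transfer, intro ext)
    fix A :: imat and i j
    assume "band A"
    then have "(A \<odot> imat_one) i j = (\<Sum>k | A i k \<noteq> 0. if k = j then A i k else 0)"
      by (simp add: imat_mult_band_left(2) imat_one_def if_distrib cong: if_cong)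
    then show "(A \<odot> imat_one) i j = A i j"
      using imat_mult_band_left(1)[OF \<open>band A\<close>, of i] by auto
  qed
  show "(0::band_matrix) \<noteq> 1"
    by transfer (auto simp: imat_zero_def imat_one_def fun_eq_iff)
  show "A + B + C = A + (B + C)"
    by transfer (simp add: add.assoc)
  show "A + B = B + A"
    by transfer (simp add: add.commute)
  show "0 + A = A"
    by transfer (simp add: imat_zero_def)
  show "- A + A = 0"
    by transfer (simp add: imat_zero_def)
  show "A - B = A + - B"
    by transfer (simp add: imat_diff_def)
qed

end

lift_definition adj :: "band_matrix \<Rightarrow> band_matrix" is adjoint
  by (rule band_adjoint)

lift_definition scalar :: "complex \<Rightarrow> band_matrix" is "\<lambda>c. imat_smult c imat_one"
  by (rule band_smult_one)

lemma entry_eqI: "(\<And>i j. entry A i j = entry B i j) \<Longrightarrow> A = B"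
  by (simp add: entry_inject[symmetric] fun_eq_iff)

lemma entry_zero [simp]: "entry 0 i j = 0"
  by transfer (simp add: imat_zero_def)

lemma entry_one: "entry 1 i j = (if i = j then 1 else 0)"
  by transfer (simp add: imat_one_def)

lemma entry_diff [simp]: "entry (A - B) i j = entry A i j - entry B i j"
  by transfer (simp add: imat_diff_def)

lemma entry_adj [simp]: "entry (adj A) i j = cnj (entry A j i)"
  by transfer (simp add: adjoint_def)

lemma entry_times_lessThan:
  assumes "\<And>k. entry A i k \<noteq> 0 \<Longrightarrow> k < n"
  shows "entry (A * B) i j = (\<Sum>k<n. entry A i k * entry B k j)"
  using assms by transfer (rule imat_mult_lessThan)

lemma entry_scalar_times: "entry (scalar c * A) i j = c * entry A i j"
  by (subst entry_times_lessThan[of _ _ "Suc i"])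
    (simp_all add: scalar.rep_eq imat_smult_def imat_one_def split: if_splits)

lemma entry_times_right:
  assumes "\<And>k. k > d \<Longrightarrow> entry B k j = 0"
  shows "entry (A * B) i j = (\<Sum>k\<le>d. entry A i k * entry B k j)"
  unfolding times_band_matrix.rep_eq imat_mult_def
  by (rule suminf_finite) (use assms in auto)

lemma adj_adj [simp]: "adj (adj A) = A"
  by (rule entry_eqI) simp

lemma adj_diff: "adj (A - B) = adj A - adj B"
  by (rule entry_eqI) simp

lemma adj_zero [simp]: "adj 0 = 0"
  by (rule entry_eqI) simp

lemma adj_one [simp]: "adj 1 = 1"
  by (rule entry_eqI) (simp add: entry_one)

lemma adj_times: "adj (A * B) = adj B * adj A"
proof (rule entry_eqI)
  fix i j :: nat
  have "finite {k. entry B k i \<noteq> 0}"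
    by (rule imat_mult_band_right(1)) (use entry in auto)
  then obtain n where n: "\<And>k. entry B k i \<noteq> 0 \<Longrightarrow> k < n"
    unfolding finite_nat_set_iff_bounded by blast
  have "entry (A * B) j i = (\<Sum>k\<le>n. entry A j k * entry B k i)"
    by (rule entry_times_right) (use n less_asym in blast)
  also have "\<dots> = (\<Sum>k<Suc n. entry A j k * entry B k i)"
    by (simp add: lessThan_Suc_atMost)
  finally show "entry (adj (A * B)) i j = entry (adj B * adj A) i j"
    by (subst entry_times_lessThan[of _ _ "Suc n"])
      (auto simp: mult.commute simp del: sum.lessThan_Suc dest: n intro: less_SucI)
qed

lemma adj_power: "adj (A ^ n) = adj A ^ n"
  by (induction n) (simp_all add: adj_times power_commutes)

section \<open>The entries of a CMV matrix\<close>

lemma imat_mult_block_sum: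
  "block_sum A \<odot> block_sum B = block_sum (\<lambda>p r s. A p r 0 * B p 0 s + A p r 1 * B p 1 s)"
proof (intro ext)
  fix i j :: nat
  let ?p = "i div 2"
  have "(block_sum A \<odot> block_sum B) i j
    = (\<Sum>k\<in>{2 * ?p, 2 * ?p + 1}. block_sum A i k * block_sum B k j)"
    unfolding imat_mult_def
  proof (rule suminf_finite)
    fix k assume "k \<notin> {2 * ?p, 2 * ?p + 1}"
    then have "i div 2 \<noteq> k div 2" by (simp, presburger)
    then show "block_sum A i k * block_sum B k j = 0" by (simp add: block_sum_def)
  qed simp
  then show "(block_sum A \<odot> block_sum B) i j
    = block_sum (\<lambda>p r s. A p r 0 * B p 0 s + A p r 1 * B p 1 s) i j"
    by (simp add: block_sum_def)
qed

lemma imat_mult_one_oplus: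
  assumes "band A"
  shows "one_oplus A \<odot> one_oplus B = one_oplus (A \<odot> B)"
proof (intro ext)
  fix i j
  obtain n where n: "\<And>k. A (i - 1) k \<noteq> 0 \<Longrightarrow> k < n"
    using imat_mult_band_left(1)[OF assms, of "i - 1"]
    unfolding finite_nat_set_iff_bounded by blast
  have "k < Suc n" if "one_oplus A i k \<noteq> 0" for k
    using that n[of "k - 1"] by (cases k) (auto simp: one_oplus_def split: if_splits)
  then have "(one_oplus A \<odot> one_oplus B) i j
    = (\<Sum>k<Suc n. one_oplus A i k * one_oplus B k j)"
    by (rule imat_mult_lessThan)
  also have "\<dots> = one_oplus A i 0 * one_oplus B 0 j
    + (\<Sum>k<n. one_oplus A i (Suc k) * one_oplus B (Suc k) j)"
    by (rule sum.lessThan_Suc_shift)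
  also have "\<dots> = one_oplus (A \<odot> B) i j"
    using imat_mult_lessThan[of A "i - 1" n B "j - 1"] n by (simp add: one_oplus_def)
  finally show "(one_oplus A \<odot> one_oplus B) i j = one_oplus (A \<odot> B) i j" .
qed

lemma adjoint_block_sum: "adjoint (block_sum B) = block_sum (\<lambda>p r s. cnj (B p s r))"
  by (auto simp: adjoint_def block_sum_def fun_eq_iff)

lemma adjoint_one_oplus: "adjoint (one_oplus A) = one_oplus (adjoint A)"
  by (auto simp: adjoint_def one_oplus_def fun_eq_iff)

lemma block_sum_one:
  assumes "\<And>p r s. r < 2 \<Longrightarrow> s < 2 \<Longrightarrow> B p r s = (if r = s then 1 else 0)"
  shows "block_sum B = imat_one"
proof (intro ext)
  fix i j :: nat
  have "i = j \<longleftrightarrow> i div 2 = j div 2 \<and> i mod 2 = j mod 2"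
    by (metis div_mult_mod_eq)
  then show "block_sum B i j = imat_one i j"
    by (auto simp: block_sum_def imat_one_def assms)
qed

lemma one_oplus_one: "one_oplus imat_one = imat_one"
  by (auto simp: one_oplus_def imat_one_def fun_eq_iff)

lift_definition cmvL :: "(nat \<Rightarrow> complex) \<Rightarrow> band_matrix" is cmv_L
  by (rule band_cmv_L)

lift_definition cmvM :: "(nat \<Rightarrow> complex) \<Rightarrow> band_matrix" is cmv_M
  by (rule band_cmv_M)

lift_definition cmvC :: "(nat \<Rightarrow> complex) \<Rightarrow> band_matrix" is cmv
  by (rule band_cmv)

lemma cmvC_eq: "cmvC \<alpha> = cmvL \<alpha> * cmvM \<alpha>"
  by transfer (rule cmv_def)

lemma cmv_M_Suc_Suc:
  "cmv_M \<alpha> (Suc i) (Suc j)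
    = (if i div 2 = j div 2 then Theta \<alpha> (2 * (i div 2) + 1) (i mod 2) (j mod 2) else 0)"
  by (simp add: cmv_M_def one_oplus_def block_sum_def)

lemma cmv_M_0: "cmv_M \<alpha> 0 j = (if j = 0 then 1 else 0)" "cmv_M \<alpha> i 0 = (if i = 0 then 1 else 0)"
  by (simp_all add: cmv_M_def one_oplus_def)

lemma cmvC_entry:
  "entry (cmvC \<alpha>) i j =
    Theta \<alpha> (2 * (i div 2)) (i mod 2) 0 * cmv_M \<alpha> (2 * (i div 2)) j +
    Theta \<alpha> (2 * (i div 2)) (i mod 2) 1 * cmv_M \<alpha> (Suc (2 * (i div 2))) j"
proof -
  let ?p = "i div 2"
  have "cmv \<alpha> i j = (\<Sum>k\<in>{2 * ?p, Suc (2 * ?p)}. cmv_L \<alpha> i k * cmv_M \<alpha> k j)"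
    unfolding imat_mult_def cmv_def
  proof (rule suminf_finite)
    fix k assume "k \<notin> {2 * ?p, Suc (2 * ?p)}"
    then have "i div 2 \<noteq> k div 2" by (simp, presburger)
    then show "cmv_L \<alpha> i k * cmv_M \<alpha> k j = 0" by (simp add: cmv_L_def block_sum_def)
  qed simp
  then show ?thesis
    by (simp add: cmvC.rep_eq cmv_L_def block_sum_def)
qed

lemma cmv_M_nonzero:
  assumes "cmv_M \<alpha> i j \<noteq> 0"
  shows "Suc i div 2 = Suc j div 2"
proof (cases "i = 0 \<or> j = 0")
  case True
  then show ?thesis using assms by (auto simp: cmv_M_0 split: if_splits)
next
  case False
  then obtain i' j' where "i = Suc i'" "j = Suc j'"
    by (meson not0_implies_Suc)
  then show ?thesis using assms by (simp add: cmv_M_Suc_Suc split: if_splits)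
qed

text \<open>The nonzero entries of row \<open>i\<close> lie in the four columns from \<open>2 p - 1\<close> to \<open>2 p + 2\<close> where
  \<open>p = i div 2\<close>.  Consequently, along an odd column the matrix reaches two places down, along an
  even column only one; for the adjoint the parities are exchanged.\<close>

lemma cmvC_nonzero:
  assumes "entry (cmvC \<alpha>) i j \<noteq> 0"
  shows "2 * (i div 2) \<le> j + 1" "j \<le> 2 * (i div 2) + 2"
proof -
  define p where "p = i div 2"
  have "cmv_M \<alpha> (2 * p) j \<noteq> 0 \<or> cmv_M \<alpha> (Suc (2 * p)) j \<noteq> 0"
    using assms unfolding cmvC_entry p_def by auto
  then have "Suc (2 * p) div 2 = Suc j div 2 \<or> Suc (Suc (2 * p)) div 2 = Suc j div 2"
    using cmv_M_nonzero by blast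
  then have "2 * p \<le> j + 1 \<and> j \<le> 2 * p + 2" by linarith
  then show "2 * (i div 2) \<le> j + 1" "j \<le> 2 * (i div 2) + 2" unfolding p_def by simp_all
qed

lemma cmvC_special_entries:
  "entry (cmvC \<alpha>) (2 * p + 3) (2 * p + 1) = rho \<alpha> (2 * p + 2) * rho \<alpha> (2 * p + 1)"
  "entry (cmvC \<alpha>) (2 * p) (2 * p + 2) = rho \<alpha> (2 * p) * rho \<alpha> (2 * p + 1)"
  "entry (cmvC \<alpha>) (2 * p) (2 * p + 1) = rho \<alpha> (2 * p) * cnj (\<alpha> (2 * p + 1))"
  "entry (cmvC \<alpha>) (2 * p + 2) (2 * p + 1) = cnj (\<alpha> (2 * p + 2)) * rho \<alpha> (2 * p + 1)"
  "entry (cmvC \<alpha>) 1 0 = rho \<alpha> 0"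
  "entry (cmvC \<alpha>) 0 0 = cnj (\<alpha> 0)"
proof -
  have zero: "cmv_M \<alpha> i j = 0" if "Suc i div 2 \<noteq> Suc j div 2" for i j
    using cmv_M_nonzero that by blast
  have M1: "cmv_M \<alpha> (2 * p) (2 * p + 1) = 0" by (rule zero) simp
  have M2: "cmv_M \<alpha> (2 * p) (2 * p + 2) = 0" by (rule zero) simp
  have M3: "cmv_M \<alpha> (2 * p + 3) (2 * p + 1) = 0" by (rule zero) simp
  have M': "cmv_M \<alpha> (2 * p + 1) (2 * p + 1) = cnj (\<alpha> (2 * p + 1))"
    "cmv_M \<alpha> (2 * p + 1) (2 * p + 2) = rho \<alpha> (2 * p + 1)"
    "cmv_M \<alpha> (2 * p + 2) (2 * p + 1) = rho \<alpha> (2 * p + 1)"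
    using cmv_M_Suc_Suc[of \<alpha> "2 * p" "2 * p"] cmv_M_Suc_Suc[of \<alpha> "2 * p" "2 * p + 1"]
      cmv_M_Suc_Suc[of \<alpha> "2 * p + 1" "2 * p"] by (auto simp: Theta_def)
  have d: "(2 * p + 3) div 2 = p + 1" "(2 * p + 3) mod 2 = 1"
    "(2 * p + 2) div 2 = p + 1" "(2 * p + 2) mod 2 = 0" by presburger+
  show "entry (cmvC \<alpha>) (2 * p + 3) (2 * p + 1) = rho \<alpha> (2 * p + 2) * rho \<alpha> (2 * p + 1)"
    using M3 M'(3) unfolding cmvC_entry d by (simp add: Theta_def eval_nat_numeral)
  show "entry (cmvC \<alpha>) (2 * p) (2 * p + 2) = rho \<alpha> (2 * p) * rho \<alpha> (2 * p + 1)"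
    using M2 M'(2) unfolding cmvC_entry by (simp add: Theta_def)
  show "entry (cmvC \<alpha>) (2 * p) (2 * p + 1) = rho \<alpha> (2 * p) * cnj (\<alpha> (2 * p + 1))"
    using M1 M'(1) unfolding cmvC_entry by (simp add: Theta_def)
  show "entry (cmvC \<alpha>) (2 * p + 2) (2 * p + 1) = cnj (\<alpha> (2 * p + 2)) * rho \<alpha> (2 * p + 1)"
    using M3 M'(3) unfolding cmvC_entry d by (simp add: Theta_def eval_nat_numeral)
  show "entry (cmvC \<alpha>) 1 0 = rho \<alpha> 0" "entry (cmvC \<alpha>) 0 0 = cnj (\<alpha> 0)"
    unfolding cmvC_entry by (simp_all add: Theta_def cmv_M_0)
qed

lemma Theta_unitary:
  assumes "cmod (\<alpha> n) < 1" "r < 2" "s < 2"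
  shows "Theta \<alpha> n r 0 * cnj (Theta \<alpha> n s 0) + Theta \<alpha> n r 1 * cnj (Theta \<alpha> n s 1)
      = (if r = s then 1 else 0)"
    and "cnj (Theta \<alpha> n 0 r) * Theta \<alpha> n 0 s + cnj (Theta \<alpha> n 1 r) * Theta \<alpha> n 1 s
      = (if r = s then 1 else 0)"
proof -
  have "(cmod (\<alpha> n))\<^sup>2 \<le> 1" using assms(1) by (simp add: power_le_one)
  then have "rho \<alpha> n * rho \<alpha> n = 1 - (cmod (\<alpha> n))\<^sup>2" by (simp add: rho_def)
  then have "complex_of_real (rho \<alpha> n * rho \<alpha> n) = complex_of_real (1 - (cmod (\<alpha> n))\<^sup>2)"
    by (rule arg_cong)
  then have "complex_of_real (rho \<alpha> n) * complex_of_real (rho \<alpha> n) = 1 - \<alpha> n * cnj (\<alpha> n)"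
    by (simp only: of_real_mult of_real_diff of_real_1 complex_norm_square)
  then have "\<alpha> n * cnj (\<alpha> n) = 1 - complex_of_real (rho \<alpha> n) * complex_of_real (rho \<alpha> n)"
    "cnj (\<alpha> n) * \<alpha> n = 1 - complex_of_real (rho \<alpha> n) * complex_of_real (rho \<alpha> n)"
    by (simp_all add: mult.commute)
  moreover have "r = 0 \<or> r = 1" "s = 0 \<or> s = 1" using assms by auto
  ultimately show "Theta \<alpha> n r 0 * cnj (Theta \<alpha> n s 0) + Theta \<alpha> n r 1 * cnj (Theta \<alpha> n s 1)
      = (if r = s then 1 else 0)"
    and "cnj (Theta \<alpha> n 0 r) * Theta \<alpha> n 0 s + cnj (Theta \<alpha> n 1 r) * Theta \<alpha> n 1 s
      = (if r = s then 1 else 0)"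
    by (auto simp: Theta_def)
qed

section \<open>Conjugation by powers of a CMV matrix\<close>

locale verblunsky =
  fixes \<alpha> :: "nat \<Rightarrow> complex"
  assumes cmod_less_1: "cmod (\<alpha> k) < 1"
begin

lemma rho_nonzero [simp]: "rho \<alpha> k \<noteq> 0"
proof -
  have "(cmod (\<alpha> k))\<^sup>2 < 1" using cmod_less_1 by (simp add: abs_square_less_1)
  then show ?thesis by (simp add: rho_def)
qed

abbreviation "C \<equiv> cmvC \<alpha>"

abbreviation "D \<equiv> adj C"

lemma cmvL_unitary: "cmvL \<alpha> * adj (cmvL \<alpha>) = 1" "adj (cmvL \<alpha>) * cmvL \<alpha> = 1"
  unfolding entry_inject[symmetric] times_band_matrix.rep_eq adj.rep_eq cmvL.rep_eq
    one_band_matrix.rep_eq cmv_L_def adjoint_block_sum imat_mult_block_sum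
  by (rule block_sum_one; simp only: Theta_unitary[OF cmod_less_1])+

lemma cmvM_unitary: "cmvM \<alpha> * adj (cmvM \<alpha>) = 1" "adj (cmvM \<alpha>) * cmvM \<alpha> = 1"
  unfolding entry_inject[symmetric] times_band_matrix.rep_eq adj.rep_eq cmvM.rep_eq
    one_band_matrix.rep_eq cmv_M_def adjoint_one_oplus adjoint_block_sum
    imat_mult_one_oplus[OF band_block_sum] imat_mult_block_sum
  by (subst block_sum_one; simp only: Theta_unitary[OF cmod_less_1] one_oplus_one)+

lemma CD: "C * D = 1" and DC: "D * C = 1"
proof -
  have "C * D = cmvL \<alpha> * (cmvM \<alpha> * adj (cmvM \<alpha>)) * adj (cmvL \<alpha>)"
    by (simp only: cmvC_eq adj_times mult.assoc)
  then show "C * D = 1" by (simp add: cmvL_unitary cmvM_unitary)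
  have "D * C = adj (cmvM \<alpha>) * (adj (cmvL \<alpha>) * cmvL \<alpha>) * cmvM \<alpha>"
    by (simp only: cmvC_eq adj_times mult.assoc)
  then show "D * C = 1" by (simp add: cmvL_unitary cmvM_unitary)
qed

lemma CD_left [simp]: "C * (D * X) = X" and DC_left [simp]: "D * (C * X) = X"
  by (simp_all add: mult.assoc[symmetric] CD DC)

definition zpow :: "int \<Rightarrow> band_matrix" where
  "zpow k = (if 0 \<le> k then C ^ nat k else D ^ nat (- k))"

lemma zpow_0 [simp]: "zpow 0 = 1"
  by (simp add: zpow_def)

lemma zpow_of_nat: "zpow (int n) = C ^ n" "zpow (- int n) = D ^ n"
  by (auto simp: zpow_def)

lemma zpow_Suc: "zpow (k + 1) = C * zpow k"
proof (cases k)
  case (nonneg n)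
  then show ?thesis using zpow_of_nat(1)[of "Suc n"] by (simp add: zpow_of_nat add.commute)
next
  case (neg n)
  then show ?thesis using zpow_of_nat(2)[of n] zpow_of_nat(2)[of "Suc n"] by simp
qed

lemma zpow_pred: "zpow (k - 1) = D * zpow k"
  using zpow_Suc[of "k - 1"] by simp

lemma zpow_add: "zpow (j + k) = zpow j * zpow k"
proof (induction j rule: int_induct[of _ 0])
  case (step1 i)
  then show ?case using zpow_Suc[of "i + k"] zpow_Suc[of i] by (simp add: algebra_simps)
next
  case (step2 i)
  then show ?case using zpow_pred[of "i + k"] zpow_pred[of i] by (simp add: algebra_simps)
qed simp

lemma zpow_Suc_right: "zpow (k + 1) = zpow k * C"
  using zpow_add[of k 1] zpow_of_nat(1)[of 1] by simp

lemma adj_zpow: "adj (zpow k) = zpow (- k)"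
  by (cases k) (simp_all add: zpow_of_nat adj_power del: of_nat_Suc power_Suc)

definition delta :: "band_matrix \<Rightarrow> band_matrix" where
  "delta X = D * X * C - X"

text \<open>The first column of \<open>conjugate \<Omega> k\<close> is the vector \<open>w\<^sub>k\<close> of the introduction.\<close>

definition conjugate :: "band_matrix \<Rightarrow> int \<Rightarrow> band_matrix" where
  "conjugate X k = zpow (- k) * X * zpow k"

text \<open>Passing from \<open>k\<close> to \<open>k + 1\<close> inserts one more conjugation by \<open>C\<close> in the middle of
  \<open>C\<^sup>-\<^sup>k X C\<^sup>k\<close>, so differences in \<open>k\<close> become applications of \<open>\<delta>\<close> to \<open>X\<close>.\<close>

lemma diff_pow_conjugate: "(diff ^^ n) (conjugate X) = conjugate ((delta ^^ n) X)"
proof (induction n arbitrary: X)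
  case (Suc n)
  have "zpow (- (k + 1)) = zpow (- k) * D" for k
    using zpow_add[of "- k" "- 1"] zpow_of_nat(2)[of 1] by simp
  then have "diff (conjugate X) = conjugate (delta X)"
    unfolding diff_def conjugate_def delta_def zpow_Suc by (simp add: algebra_simps)
  then show ?case
    using Suc[of "delta X"] by (simp only: diff_pow_Suc funpow_Suc_right o_def)
qed simp

lemma delta_pow_adj: "(delta ^^ n) (adj X) = adj ((delta ^^ n) X)"
  by (induction n) (simp_all add: delta_def adj_diff adj_times mult.assoc)

text \<open>Since \<open>\<delta> X = - C\<^sup>-\<^sup>1 (ad C) X\<close> and multiplication by \<open>C\<^sup>-\<^sup>1\<close> commutes with \<open>ad C\<close>, the
  \<open>n\<close>-th iterate of \<open>\<delta>\<close> is that of \<open>ad C\<close> followed by an invertible factor.\<close>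

lemma delta_pow_eq_0:
  assumes "((\<lambda>X. C * X - X * C) ^^ n) X = 0"
  shows "(delta ^^ n) X = 0"
proof -
  let ?a = "\<lambda>X. C * X - X * C"
  have D_commute: "(?a ^^ n) (D * Y) = D * (?a ^^ n) Y" for n Y
    by (induction n) (simp_all add: algebra_simps)
  have minus_commute: "(?a ^^ n) (- Y) = - (?a ^^ n) Y" for n Y
    by (induction n) simp_all
  have delta: "delta Y = - (D * ?a Y)" for Y
    by (simp add: delta_def algebra_simps)
  show ?thesis using assms
  proof (induction n arbitrary: X)
    case (Suc n)
    have "(?a ^^ n) (delta X) = - (D * (?a ^^ Suc n) X)"
      unfolding delta minus_commute D_commute by (simp only: funpow_Suc_right o_def)
    then have "(?a ^^ n) (delta X) = 0" by (simp only: Suc.prems mult_zero_right minus_zero)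
    then show ?case using Suc.IH by (simp only: funpow_Suc_right o_def)
  qed simp
qed

section \<open>Supports of first columns\<close>

text \<open>Vectors are represented as first columns of band matrices, so that applying a matrix to a
  vector is a product in the ring, and \<open>zpow k\<close> represents \<open>v\<^sub>k = C\<^sup>k e\<^sub>0\<close>.\<close>

definition col_le :: "nat \<Rightarrow> band_matrix \<Rightarrow> bool" where
  "col_le d X \<longleftrightarrow> (\<forall>i>d. entry X i 0 = 0)"

lemma col_leD: "col_le d X \<Longrightarrow> i > d \<Longrightarrow> entry X i 0 = 0"
  by (simp add: col_le_def)

lemma col_le_exists: "\<exists>d. col_le d X"
proof -
  have "finite {k. entry X k 0 \<noteq> 0}"
    by (rule imat_mult_band_right(1)) (use entry in auto)
  then obtain n where n: "\<And>k. entry X k 0 \<noteq> 0 \<Longrightarrow> k < n"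
    unfolding finite_nat_set_iff_bounded by blast
  then show ?thesis unfolding col_le_def using less_asym by blast
qed

lemma entry_times_col:
  "col_le d X \<Longrightarrow> entry (A * X) i 0 = (\<Sum>k\<le>d. entry A i k * entry X k 0)"
  by (rule entry_times_right) (rule col_leD)

lemma entry_times_col_0: "col_le 0 X \<Longrightarrow> entry (A * X) i 0 = entry A i 0 * entry X 0 0"
  by (simp add: entry_times_col)

text \<open>Only column \<open>d\<close> contributes to row \<open>e\<close>, so nothing can cancel at the top of the product.\<close>

lemma col_le_times:
  assumes "col_le d X"
    and "\<forall>i j. entry A i j \<noteq> 0 \<and> j \<le> d \<longrightarrow> i \<le> e \<and> (i = e \<longrightarrow> j = d)"
  shows "col_le e (A * X)" "entry (A * X) e 0 = entry A e d * entry X d 0"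
proof -
  show "col_le e (A * X)"
    unfolding col_le_def entry_times_col[OF assms(1)]
    using assms(2) by (intro allI impI sum.neutral) (metis atMost_iff mult_eq_0_iff not_le)
  have "entry (A * X) e 0 = (\<Sum>k\<in>{d}. entry A e k * entry X k 0)"
    unfolding entry_times_col[OF assms(1)]
    by (rule sum.mono_neutral_right) (use assms(2) in auto)
  then show "entry (A * X) e 0 = entry A e d * entry X d 0" by simp
qed

text \<open>A top coordinate of odd index is moved up by two by \<open>C\<close>, one of even index by the inverse of
  \<open>C\<close>.  It cannot be cancelled there, because no lower coordinate gets that far, and the factor it
  picks up is a product of two \<open>\<rho>\<close>'s.\<close>

lemma C_step:
  assumes "col_le (2 * m + 1) X"
  shows "col_le (2 * m + 3) (C * X)"
    and "entry (C * X) (2 * m + 3) 0 = 0 \<longleftrightarrow> entry X (2 * m + 1) 0 = 0"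
proof -
  have "i \<le> 2 * m + 3 \<and> (i = 2 * m + 3 \<longrightarrow> j = 2 * m + 1)"
    if "entry C i j \<noteq> 0" "j \<le> 2 * m + 1" for i j
    using cmvC_nonzero(1)[OF that(1)] that(2) by linarith
  then have "\<forall>i j. entry C i j \<noteq> 0 \<and> j \<le> 2 * m + 1
      \<longrightarrow> i \<le> 2 * m + 3 \<and> (i = 2 * m + 3 \<longrightarrow> j = 2 * m + 1)" by blast
  note step = col_le_times[OF assms this]
  show "col_le (2 * m + 3) (C * X)" by (rule step(1))
  show "entry (C * X) (2 * m + 3) 0 = 0 \<longleftrightarrow> entry X (2 * m + 1) 0 = 0"
    using cmvC_special_entries(1)[of \<alpha> m] by (simp add: step(2))
qed

lemma D_step:
  assumes "col_le (2 * m) X"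
  shows "col_le (2 * m + 2) (D * X)"
    and "entry (D * X) (2 * m + 2) 0 = 0 \<longleftrightarrow> entry X (2 * m) 0 = 0"
proof -
  have "i \<le> 2 * m + 2 \<and> (i = 2 * m + 2 \<longrightarrow> j = 2 * m)"
    if "entry D i j \<noteq> 0" "j \<le> 2 * m" for i j
  proof -
    have "entry C j i \<noteq> 0" using that(1) by simp
    then show ?thesis using cmvC_nonzero(2)[of \<alpha> j i] that(2) by linarith
  qed
  then have "\<forall>i j. entry D i j \<noteq> 0 \<and> j \<le> 2 * m
      \<longrightarrow> i \<le> 2 * m + 2 \<and> (i = 2 * m + 2 \<longrightarrow> j = 2 * m)" by blast
  note step = col_le_times[OF assms this]
  show "col_le (2 * m + 2) (D * X)" by (rule step(1))
  show "entry (D * X) (2 * m + 2) 0 = 0 \<longleftrightarrow> entry X (2 * m) 0 = 0"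
    using step(2) cmvC_special_entries(2)[of \<alpha> m] by simp
qed

lemma C_power_step:
  assumes "col_le (2 * m + 1) X"
  shows "col_le (2 * (m + k) + 1) (C ^ k * X)
    \<and> (entry (C ^ k * X) (2 * (m + k) + 1) 0 = 0 \<longleftrightarrow> entry X (2 * m + 1) 0 = 0)"
proof (induction k)
  case (Suc k)
  have index: "2 * (m + Suc k) + 1 = 2 * (m + k) + 3" by simp
  show ?case
    unfolding index power_Suc mult.assoc using Suc C_step[of "m + k" "C ^ k * X"] by blast
qed (use assms in simp)

lemma D_power_step:
  assumes "col_le (2 * m) X"
  shows "col_le (2 * (m + k)) (D ^ k * X)
    \<and> (entry (D ^ k * X) (2 * (m + k)) 0 = 0 \<longleftrightarrow> entry X (2 * m) 0 = 0)"
proof (induction k)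
  case (Suc k)
  have index: "2 * (m + Suc k) = 2 * (m + k) + 2" by simp
  show ?case
    unfolding index power_Suc mult.assoc using Suc D_step[of "m + k" "D ^ k * X"] by blast
qed (use assms in simp)

text \<open>The exponent of the monomial in the sequence \<open>1, z, z\<^sup>-\<^sup>1, z\<^sup>2, z\<^sup>-\<^sup>2, \<dots>\<close> that first involves
  the \<open>j\<close>-th basis vector.\<close>

definition expo :: "nat \<Rightarrow> int" where
  "expo j = (if even j then - int (j div 2) else int (j div 2) + 1)"

lemma expo_inj: "expo i = expo j \<longleftrightarrow> i = j"
  by (auto simp: expo_def elim!: evenE oddE split: if_splits; presburger)

lemma zpow_expo_top: "col_le j (zpow (expo j)) \<and> entry (zpow (expo j)) j 0 \<noteq> 0"
proof (cases "even j")
  case True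
  then obtain k where j: "j = 2 * k" by blast
  have "col_le (2 * 0) 1" by (simp add: col_le_def entry_one)
  from D_power_step[OF this, of k] show ?thesis
    by (simp add: j expo_def zpow_of_nat entry_one)
next
  case False
  then obtain k where j: "j = 2 * k + 1" using oddE by blast
  have "i \<le> 1" if "entry C i 0 \<noteq> 0" for i
    using cmvC_nonzero(1)[OF that] by presburger
  then have "\<forall>i j. entry C i j \<noteq> 0 \<and> j \<le> 0 \<longrightarrow> i \<le> 1 \<and> (i = 1 \<longrightarrow> j = 0)" by simp
  from col_le_times[of 0 1 C 1, OF _ this]
  have "col_le (2 * 0 + 1) C" "entry C 1 0 \<noteq> 0"
    by (simp_all add: col_le_def entry_one cmvC_special_entries(5)[simplified])
  with C_power_step[of 0 C k] have "col_le j (C ^ k * C)" "entry (C ^ k * C) j 0 \<noteq> 0"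
    by (simp_all add: j)
  moreover have "zpow (expo j) = C ^ k * C"
    using zpow_Suc_right[of "int k"] by (simp add: j expo_def zpow_of_nat)
  ultimately show ?thesis by simp
qed

text \<open>The vectors \<open>v\<^sub>k\<close> form a triangular basis, so a matrix that kills all of them is zero.\<close>

lemma eq_0_if_zpow_col_0:
  assumes "\<And>k i. entry (Y * zpow k) i 0 = 0"
  shows "Y = 0"
proof -
  have "entry Y i j = 0" for i j
  proof (induction j rule: less_induct)
    case (less j)
    have "0 = (\<Sum>k\<le>j. entry Y i k * entry (zpow (expo j)) k 0)"
      using assms entry_times_col[of j "zpow (expo j)" Y i] zpow_expo_top[of j] by simp
    also have "\<dots> = (\<Sum>k\<in>{j}. entry Y i k * entry (zpow (expo j)) k 0)"
      by (rule sum.mono_neutral_right) (use less in auto)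
    finally show ?case using zpow_expo_top[of j] by simp
  qed
  then show ?thesis by (intro entry_eqI) simp
qed

section \<open>Almost tridiagonal matrices have the monomials as eigenvectors\<close>

lemma diff_pow_entry_conjugate:
  "(diff ^^ n) (\<lambda>k. entry (f k) i j) = (\<lambda>k. entry ((diff ^^ n) f k) i j)"
proof (induction n arbitrary: f)
  case (Suc n)
  have "diff (\<lambda>k. entry (f k) i j) = (\<lambda>k. entry (diff f k) i j)"
    by (simp add: diff_def)
  then show ?case by (simp only: diff_pow_Suc Suc)
qed simp

lemma diff_pow_entry_conjugate_eq_0:
  assumes "(delta ^^ n) X = 0"
  shows "(diff ^^ n) (\<lambda>k. entry (conjugate X k) i 0) = (\<lambda>_. 0)"
  unfolding diff_pow_entry_conjugate diff_pow_conjugate assms by (simp add: conjugate_def)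

text \<open>By induction the differences \<open>w (k + 1) - w k\<close> have a common support bound \<open>d\<close>, so the coordinates
  above \<open>d\<close> do not depend on \<open>k\<close>.\<close>

lemma col_le_uniform:
  assumes "(diff ^^ n) w = (\<lambda>_. 0)"
  shows "\<exists>d. \<forall>k::int. col_le d (w k)"
  using assms
proof (induction n arbitrary: w)
  case 0
  then show ?case by (simp add: col_le_def fun_eq_iff)
next
  case (Suc n)
  then obtain d where d: "col_le d (diff w k)" for k
    unfolding diff_pow_Suc by blast
  obtain e where e: "col_le e (w 0)" using col_le_exists by blast
  have "entry (w k) i 0 = 0" if "i > max d e" for k i
  proof -
    have "diff (\<lambda>k. entry (w k) i 0) = (\<lambda>_. 0)"
      using col_leD[OF d, of i] that by (simp add: diff_def)
    then have "entry (w k) i 0 = entry (w 0) i 0" by (rule diff_eq_0_const)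
    then show ?thesis using col_leD[OF e] that by simp
  qed
  then show ?case unfolding col_le_def by blast
qed

text \<open>The coordinate \<open>d + 1\<close> of \<open>w\<^sub>k\<close> becomes, in \<open>X v\<^sub>k = C\<^sup>k w\<^sub>k\<close>, a coordinate at least two places
  above the support of \<open>v\<^sub>k\<close>, provided that \<open>k\<close> is large of the sign determined by the parity
  of \<open>d + 1\<close>.  There it is zero, so it is zero for all \<open>k\<close>.\<close>

lemma lower_support:
  assumes delta: "(delta ^^ n) X = 0"
    and tri: "\<And>i j. entry X i j \<noteq> 0 \<Longrightarrow> N \<le> i \<Longrightarrow> i \<le> j + 1"
    and supp: "\<And>k. col_le (Suc d) (conjugate X k)"
  shows "col_le d (conjugate X k)"
proof -
  have mult: "X * zpow k = zpow k * conjugate X k" for k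
    using zpow_add[of k "- k"] by (simp add: conjugate_def mult.assoc[symmetric])
  have far: "entry (X * Y) i 0 = 0" if "col_le e Y" "N \<le> i" "e + 2 \<le> i" for Y e i
    unfolding entry_times_col[OF that(1)]
    by (intro sum.neutral) (use tri[of i] that in fastforce)
  let ?t = "\<lambda>k. entry (conjugate X k) (Suc d) 0"
  have "(\<forall>k\<ge>int (Suc N). ?t k = 0) \<or> (\<forall>k\<le>- int (Suc N). ?t k = 0)"
  proof (cases "even d")
    case True
    then obtain m where m: "d = 2 * m" by blast
    have "?t k = 0" if "k \<ge> int (Suc N)" for k
    proof -
      \<comment> \<open>Here \<open>v\<^sub>k\<close> is supported up to \<open>2 k - 1\<close>, and the coordinate \<open>2 m + 1\<close> moves to \<open>2 (m + k) + 1\<close>.\<close>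
      define p where "p = nat k - 1"
      have k: "k = int (Suc p)" "N \<le> p" using that by (auto simp: p_def)
      have "k = expo (2 * p + 1)" using k by (simp add: expo_def)
      then have "col_le (2 * p + 1) (zpow k)" using zpow_expo_top by metis
      then have "entry (X * zpow k) (2 * (m + Suc p) + 1) 0 = 0"
        by (rule far) (use k in auto)
      then show ?thesis
        using C_power_step[of m "conjugate X k" "Suc p"] supp[of k] zpow_of_nat(1)[of "Suc p"]
        unfolding mult by (simp add: m k(1) del: power_Suc of_nat_Suc)
    qed
    then show ?thesis by blast
  next
    case False
    then obtain m where m: "Suc d = 2 * m" "m > 0" by (metis Suc_neq_Zero even_Suc evenE mult_0_right not_gr_zero)
    have "?t k = 0" if "k \<le> - int (Suc N)" for k
    proof -
      \<comment> \<open>Here \<open>v\<^sub>k\<close> is supported up to \<open>2 p\<close>, and the coordinate \<open>2 m\<close> moves to \<open>2 (m + p)\<close>, with \<open>m > 0\<close>.\<close>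
      define p where "p = nat (- k)"
      have k: "k = - int p" "N \<le> p" using that by (auto simp: p_def)
      have "k = expo (2 * p)" using k by (simp add: expo_def)
      then have "col_le (2 * p) (zpow k)" using zpow_expo_top by metis
      then have "entry (X * zpow k) (2 * (m + p)) 0 = 0"
        by (rule far) (use k m in auto)
      then show ?thesis
        using D_power_step[of m "conjugate X k" p] supp[of k] zpow_of_nat(2)[of p]
        unfolding mult by (simp add: m k(1))
    qed
    then show ?thesis by blast
  qed
  then have "?t k = 0" for k
    using diff_pow_eq_0_half_line[OF diff_pow_entry_conjugate_eq_0[OF delta]] by blast
  then show ?thesis
    using supp[of k] unfolding col_le_def by (metis Suc_lessI)
qed

text \<open>That \<open>C\<^sup>-\<^sup>k X v\<^sub>k\<close> is a multiple of \<open>e\<^sub>0\<close> means that \<open>v\<^sub>k\<close> is an eigenvector of \<open>X\<close>; the eigenvalue is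
  \<open>entry (conjugate X k) 0 0\<close>.\<close>

lemma zpow_eigenvector:
  assumes "(delta ^^ n) X = 0"
    and "\<And>i j. entry X i j \<noteq> 0 \<Longrightarrow> N \<le> i \<Longrightarrow> i \<le> j + 1"
  shows "col_le 0 (conjugate X k)"
proof -
  have "(diff ^^ n) (conjugate X) = (\<lambda>_. 0)"
    using assms(1) by (simp add: diff_pow_conjugate conjugate_def fun_eq_iff)
  then obtain d where "\<forall>k. col_le d (conjugate X k)" using col_le_uniform by blast
  then show ?thesis
  proof (induction d arbitrary: k)
    case (Suc d)
    then show ?case using lower_support[OF assms] by blast
  qed simp
qed

section \<open>Moments\<close>

text \<open>If all nontrivial moments vanish, the \<open>v\<^sub>k\<close> are orthonormal, and being triangular they are
  multiples of the standard basis vectors.  Then \<open>C\<close> permutes these lines, so that all entries of \<open>C\<close>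
  outside one place per column are zero; among them are nonzero multiples of all Verblunsky
  coefficients.\<close>

lemma moments_determine_zero:
  assumes "\<And>m. m \<noteq> 0 \<Longrightarrow> entry (zpow m) 0 0 = 0"
  shows "\<alpha> k = 0"
proof -
  let ?u = "\<lambda>j. zpow (expo j)"
  have u: "entry (?u j) i 0 = 0" if "i \<noteq> j" for i j
    using that
  proof (induction j arbitrary: i rule: less_induct)
    case (less j)
    show ?case
    proof (cases "i < j")
      case True
      have "0 = entry (zpow (- expo i + expo j)) 0 0"
        using assms True by (simp add: expo_inj)
      also have "\<dots> = entry (adj (adj (?u j) * ?u i)) 0 0"
        by (simp only: adj_times adj_zpow zpow_add minus_minus)
      also have "\<dots> = (\<Sum>l\<le>i. entry (?u j) l 0 * cnj (entry (?u i) l 0))"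
        by (simp add: entry_times_col[of i] zpow_expo_top)
      also have "\<dots> = (\<Sum>l\<in>{i}. entry (?u j) l 0 * cnj (entry (?u i) l 0))"
        by (rule sum.mono_neutral_right) (use less.IH[OF True] in auto)
      finally show ?thesis using zpow_expo_top[of i] by simp
    next
      case False
      then show ?thesis using less.prems zpow_expo_top[of j] by (intro col_leD[of j]) auto
    qed
  qed
  have C: "entry C i j = 0" if "expo l = expo j + 1" "i \<noteq> l" for i j l
  proof -
    have "0 = entry (C * ?u j) i 0"
      using u[OF that(2)] zpow_Suc[of "expo j"] that(1) by simp
    also have "\<dots> = (\<Sum>l\<le>j. entry C i l * entry (?u j) l 0)"
      by (simp add: entry_times_col[of j] zpow_expo_top)
    also have "\<dots> = (\<Sum>l\<in>{j}. entry C i l * entry (?u j) l 0)"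
      by (rule sum.mono_neutral_right) (use u in auto)
    finally show ?thesis using zpow_expo_top[of j] by simp
  qed
  have C_odd: "entry C i (2 * p + 1) = 0" if "i \<noteq> 2 * p + 3" for i p
    by (rule C[OF _ that]) (simp add: expo_def)
  consider "k = 0" | p where "k = 2 * p + 1" | p where "k = 2 * p + 2"
    by (cases "even k"; cases k) (auto elim!: evenE oddE)
  then show ?thesis
  proof cases
    case 1
    have "entry C 0 0 = 0" by (rule C[of 1]) (simp_all add: expo_def)
    then show ?thesis using 1 cmvC_special_entries(6)[of \<alpha>] by simp
  next
    case (2 p)
    then show ?thesis using C_odd[of "2 * p" p] cmvC_special_entries(3)[of \<alpha> p] by simp
  next
    case (3 p)
    then show ?thesis using C_odd[of "2 * p + 2" p] cmvC_special_entries(4)[of \<alpha> p] by simp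
  qed
qed

text \<open>The number \<open>entry (C\<^sup>-\<^sup>j X C\<^sup>k) 0 0 = \<langle>v\<^sub>j, X v\<^sub>k\<rangle>\<close> is evaluated twice, with \<open>X\<close> acting on \<open>v\<^sub>k\<close> and
  with its adjoint acting on \<open>v\<^sub>j\<close>.\<close>

lemma eigenvalue_periodic:
  assumes "\<And>k. col_le 0 (conjugate X k)" "\<And>k. col_le 0 (conjugate (adj X) k)"
    and "entry (zpow m) 0 0 \<noteq> 0"
  shows "entry (conjugate X (j + m)) 0 0 = entry (conjugate X j) 0 0"
proof -
  have inner: "entry (zpow (- j) * Y * zpow k) 0 0 = entry (zpow (k - j)) 0 0 * entry (conjugate Y k) 0 0"
    if "\<And>k. col_le 0 (conjugate Y k)" for Y j k
  proof -
    have "zpow (- j) * Y * zpow k = zpow (k - j) * conjugate Y k"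
      using zpow_add[of "k - j" "- k"] by (simp add: conjugate_def mult.assoc[symmetric])
    then show ?thesis using entry_times_col_0[OF that] by simp
  qed
  have diag: "entry (conjugate (adj X) j) 0 0 = cnj (entry (conjugate X j) 0 0)" for j
    by (simp add: conjugate_def adj_times adj_zpow mult.assoc flip: entry_adj)
  let ?k = "j + m"
  have swap: "adj (zpow (- ?k) * adj X * zpow j) = zpow (- j) * X * zpow ?k"
    by (simp only: adj_times adj_zpow adj_adj minus_minus mult.assoc)
  have "entry (zpow m) 0 0 * entry (conjugate X ?k) 0 0 = entry (zpow (- j) * X * zpow ?k) 0 0"
    using inner[OF assms(1), of j ?k] by simp
  also have "\<dots> = cnj (entry (zpow (- ?k) * adj X * zpow j) 0 0)"
    unfolding swap[symmetric] by simp
  also have "\<dots> = cnj (entry (adj (zpow m)) 0 0) * cnj (entry (conjugate (adj X) j) 0 0)"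
    using inner[OF assms(2), of ?k j] by (simp add: adj_zpow)
  also have "\<dots> = entry (zpow m) 0 0 * entry (conjugate X j) 0 0"
    by (simp add: diag)
  finally show ?thesis using assms(3) by simp
qed

text \<open>A nonzero Verblunsky coefficient provides a nonzero moment, which makes the eigenvalues
  periodic, and being polynomial they are then constant.\<close>

lemma scalar_if_delta_pow_eq_0:
  assumes "\<alpha> l \<noteq> 0" and delta: "(delta ^^ n) X = 0"
    and tri: "\<And>i j. entry X i j \<noteq> 0 \<Longrightarrow> N \<le> i \<Longrightarrow> i \<le> j + 1"
      "\<And>i j. entry X i j \<noteq> 0 \<Longrightarrow> N \<le> j \<Longrightarrow> j \<le> i + 1"
  shows "\<exists>c. X = scalar c"
proof -
  have X: "col_le 0 (conjugate X k)" for k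
    by (rule zpow_eigenvector[OF delta tri(1)])
  have "(delta ^^ n) (adj X) = 0" by (simp add: delta_pow_adj delta)
  then have adj_X: "col_le 0 (conjugate (adj X) k)" for k
    by (rule zpow_eigenvector) (use tri(2) in auto)
  obtain m where m: "m \<noteq> 0" "entry (zpow m) 0 0 \<noteq> 0"
    using moments_determine_zero assms(1) by blast
  define c where "c = entry (conjugate X 0) 0 0"
  have b: "entry (conjugate X k) 0 0 = c" for k
    unfolding c_def
    by (rule diff_pow_eq_0_periodic[OF diff_pow_entry_conjugate_eq_0[OF delta] m(1)])
      (rule eigenvalue_periodic[OF X adj_X m(2)])
  have "X - scalar c = 0"
  proof (rule eq_0_if_zpow_col_0)
    fix k i
    have "X * zpow k = zpow k * conjugate X k"
      using zpow_add[of k "- k"] by (simp add: conjugate_def mult.assoc[symmetric])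
    then have "entry (X * zpow k) i 0 = c * entry (zpow k) i 0"
      using entry_times_col_0[OF X] by (simp add: b)
    then show "entry ((X - scalar c) * zpow k) i 0 = 0"
      by (simp add: left_diff_distrib entry_scalar_times)
  qed
  then show ?thesis by auto
qed

end

section \<open>From the ring of band matrices to infinite matrices\<close>

lemma imat_pow_entry: "imat_pow (entry A) n = entry (A ^ n)"
  by (induction n) (simp_all add: one_band_matrix.rep_eq times_band_matrix.rep_eq)

lemma ad_pow_entry: "(ad (entry A) ^^ n) (entry X) = entry (((\<lambda>X. A * X - X * A) ^^ n) X)"
  by (induction n) (simp_all add: ad_def times_band_matrix.rep_eq minus_band_matrix.rep_eq)

theorem theorem6p4:
  fixes \<alpha> :: "nat \<Rightarrow> complex" and n :: nat and \<Omega> :: imat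
  assumes "\<forall>k. cmod (\<alpha> k) < 1"
    and "\<exists>k. \<alpha> k \<noteq> 0"
    and "almost_tridiagonal \<Omega>"
    and "ad_n \<alpha> n \<Omega> = imat_zero"
  shows "\<exists>c. \<Omega> = imat_smult c imat_one"
proof -
  interpret verblunsky \<alpha> by standard (use assms(1) in blast)
  define X where "X = Band \<Omega>"
  have \<Omega>: "\<Omega> = entry X"
    using band_almost_tridiagonal[OF assms(3)] by (simp add: X_def Band_inverse)
  define Y where "Y = ((\<lambda>X. C * X - X * C) ^^ n) X"
  define m where "m = n div 2"
  have D: "imat_pow (adjoint (cmv \<alpha>)) m = entry (D ^ m)"
    by (simp add: imat_pow_entry flip: cmvC.rep_eq adj.rep_eq)
  have Y: "(ad (cmv \<alpha>) ^^ n) \<Omega> = entry Y"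
    by (simp add: \<Omega> Y_def ad_pow_entry flip: cmvC.rep_eq)
  \<comment> \<open>The unitary factors in the definition of \<^const>\<open>ad_n\<close> can be cancelled.\<close>
  have cancel: "Z = 0" if "D ^ m * Z * D ^ m = 0" for Z
  proof -
    have CD_pow: "C ^ m * D ^ m = 1" "D ^ m * C ^ m = 1"
      using zpow_add[of "int m" "- int m"] zpow_add[of "- int m" "int m"]
      by (simp_all add: zpow_of_nat)
    have "Z = C ^ m * D ^ m * Z * (D ^ m * C ^ m)" by (simp add: CD_pow)
    also have "\<dots> = C ^ m * (D ^ m * Z * D ^ m) * C ^ m" by (simp only: mult.assoc)
    finally show ?thesis by (simp add: that)
  qed
  have "Y = 0"
  proof (cases "even n")
    case True
    then have "entry (D ^ m * Y * D ^ m) = ad_n \<alpha> n \<Omega>"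
      by (simp only: ad_n_def Let_def if_True times_band_matrix.rep_eq D Y flip: m_def)
    also have "\<dots> = entry 0" by (simp only: assms(4) zero_band_matrix.rep_eq)
    finally have "D ^ m * Y * D ^ m = 0" by (simp only: entry_inject)
    then show ?thesis by (rule cancel)
  next
    case False
    let ?L = "cmvL \<alpha>" and ?M = "cmvM \<alpha>"
    have "entry (adj ?L * D ^ m * Y * D ^ m * adj ?M) = ad_n \<alpha> n \<Omega>"
      using False
      by (simp only: ad_n_def Let_def if_False times_band_matrix.rep_eq D Y
          adj.rep_eq cmvL.rep_eq cmvM.rep_eq flip: m_def)
    also have "\<dots> = entry 0" by (simp only: assms(4) zero_band_matrix.rep_eq)
    finally have 0: "adj ?L * D ^ m * Y * D ^ m * adj ?M = 0" by (simp only: entry_inject)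
    have "D ^ m * Y * D ^ m = ?L * adj ?L * (D ^ m * Y * D ^ m) * (adj ?M * ?M)"
      by (simp add: cmvL_unitary cmvM_unitary)
    also have "\<dots> = ?L * (adj ?L * D ^ m * Y * D ^ m * adj ?M) * ?M" by (simp only: mult.assoc)
    finally have "D ^ m * Y * D ^ m = 0" by (simp only: 0 mult_zero_left mult_zero_right)
    then show ?thesis by (rule cancel)
  qed
  then have delta: "(delta ^^ n) X = 0"
    unfolding Y_def by (rule delta_pow_eq_0)
  obtain T where T: "tridiagonal T" and fin: "finite {(i, j). \<Omega> i j - T i j \<noteq> 0}"
    using assms(3) unfolding almost_tridiagonal_def by blast
  \<comment> \<open>Beyond the finitely many exceptional positions \<open>\<Omega>\<close> is tridiagonal.\<close>
  let ?S = "{(i, j). \<Omega> i j - T i j \<noteq> 0}"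
  have "finite (fst ` ?S \<union> snd ` ?S)" using fin by simp
  then obtain N where N: "\<And>x. x \<in> fst ` ?S \<union> snd ` ?S \<Longrightarrow> x < N"
    unfolding finite_nat_set_iff_bounded by blast
  have tri: "i \<le> j + 1 \<and> j \<le> i + 1" if "entry X i j \<noteq> 0" "N \<le> i \<or> N \<le> j" for i j
  proof -
    have "(i, j) \<notin> ?S"
      using N[of i] N[of j] that(2) by (force simp: image_iff)
    then show ?thesis using T that(1) by (auto simp: \<Omega> tridiagonal_def)
  qed
  obtain l where "\<alpha> l \<noteq> 0" using assms(2) by blast
  from scalar_if_delta_pow_eq_0[OF this delta, of N] tri
  obtain c where "X = scalar c" by blast
  then show ?thesis by (auto simp: \<Omega> scalar.rep_eq)
qed

end
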